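(* Let $h:\mathbb{R}^d\to\mathbb{R}^p$ with $p\le d$, let $\mathbf{X}\sim F$ be a $d$-dimensional random vector, and let $\mathbf{X}^c:=\{\mathbf{X}\sim F : h(\mathbf{X})=\mathbf{0}\}$ be the constrained random vector, with joint CDF $F^c$. Assume that the constraints $h(\mathbf{X})=\mathbf{0}$ are compatible and that $F^c$ is a non-degenerate CDF. Then, for $j\in\{1,\dots,d\}$, there exist a function $r_j:\mathbb{R}^d\to\mathbb{R}^{d-1}$ and a vector $\mathbf{Z}\sim F_{\mathbf{Z}}$ of $d-1$ independent random variables such that $\mathbf{Z}$ is independent of $X_j^c$ and $$\mathbf{X}^c_{\sim j}=r_j(X^c_j,\mathbf{Z}),$$ where the equality is understood as that of a dependency model, i.e. $(X_j^c,\mathbf{X}^c_{\sim j})\stackrel{d}{=}(X_j^c,r_j(X_j^c,\mathbf{Z}))$.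
   Context: $\mathbf{X}=(X_1,\dots,X_d)$ is a random vector of continuous variables with joint cumulative distribution function (CDF) $F$. For the equations $h(\mathbf{X})=\mathbf{0}$, which are assumed compatible (simultaneously satisfiable), $\mathbf{X}^c=(X_1^c,\dots,X_d^c)$ denotes the random vector distributed as $\mathbf{X}$ subject to $h(\mathbf{X})=\mathbf{0}$; its joint CDF is denoted $F^c$. For an index $j$, $\mathbf{X}^c_{\sim j}=(X^c_{w_1},\dots,X^c_{w_{d-1}})$ where $(w_1,\dots,w_{d-1})$ is a permutation of $\{1,\dots,d\}\setminus\{j\}$. A CDF is degenerate if it is the CDF of a Dirac measure (point mass). The symbol $\stackrel{d}{=}$ denotes equality in distribution. A dependency model of a random vector $\mathbf{X}$ with explanatory variable $X_j$ is a function $r_j$ and a vector $\mathbf{Z}$ of $d-1$ independent variables, independent of $X_j$, such that $\mathbf{X}_{\sim j}\stackrel{d}{=}r_j(X_j,\mathbf{Z})$ and $(X_j,\mathbf{X}_{\sim j})\stackrel{d}{=}(X_j,r_j(X_j,\mathbf{Z}))$. *)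

theory Defs
  imports "HOL-Probability.Probability"
begin

text \<open>The space \<open>\<real>\<^sup>n\<close>, with coordinates numbered \<open>1, \<dots>, n\<close>, and its Borel sigma-algebra.\<close>

definition Rn :: "nat \<Rightarrow> (nat \<Rightarrow> real) measure" where
  "Rn n = (\<Pi>\<^sub>M i\<in>{1..n}. borel)"

definition zero_vec :: "nat \<Rightarrow> nat \<Rightarrow> real" where
  "zero_vec n = (\<lambda>i\<in>{1..n}. 0)"

definition joint_cdf :: "nat \<Rightarrow> (nat \<Rightarrow> real) measure \<Rightarrow> (nat \<Rightarrow> real) \<Rightarrow> real" where
  "joint_cdf n \<mu> x = measure \<mu> {y \<in> space \<mu>. \<forall>i\<in>{1..n}. y i \<le> x i}"

definition degenerate_cdf :: "nat \<Rightarrow> ((nat \<Rightarrow> real) \<Rightarrow> real) \<Rightarrow> bool" where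
  "degenerate_cdf n G \<longleftrightarrow> (\<exists>a\<in>space (Rn n). G = joint_cdf n (return (Rn n) a))"

definition regular_cond_dist ::
    "'a measure \<Rightarrow> 'b measure \<Rightarrow> ('a \<Rightarrow> 'b) \<Rightarrow> 'c measure \<Rightarrow> ('a \<Rightarrow> 'c) \<Rightarrow> ('c \<Rightarrow> 'b measure) \<Rightarrow> bool" where
  "regular_cond_dist M S X T Y \<kappa> \<longleftrightarrow>
     \<kappa> \<in> T \<rightarrow>\<^sub>M prob_algebra S \<and>
     (\<forall>A\<in>sets S. \<forall>B\<in>sets T.
        emeasure M {\<omega> \<in> space M. X \<omega> \<in> A \<and> Y \<omega> \<in> B} =
        (\<integral>\<^sup>+ y\<in>B. emeasure (\<kappa> y) A \<partial>distr M T Y))"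

text \<open>
  \<open>\<mu>\<close> is the law of \<open>X\<close> subject to \<open>h X = 0\<close>: the value at \<open>0\<close> of a regular conditional
  distribution of \<open>X\<close> given \<open>h X\<close> whose value at \<open>0\<close> is carried by the constraint set.
  The event \<open>h X = 0\<close> is typically null, and then the regular conditional distribution does not
  determine its value at \<open>0\<close>; every version carried by the constraint set is admitted. If the
  event has positive probability, \<open>\<mu>\<close> is the elementary conditional law
  (lemma \<open>constrained_law_elementary\<close>).
\<close>

definition constrained_law ::
    "'a measure \<Rightarrow> nat \<Rightarrow> nat \<Rightarrow> ('a \<Rightarrow> nat \<Rightarrow> real) \<Rightarrow> ((nat \<Rightarrow> real) \<Rightarrow> nat \<Rightarrow> real) \<Rightarrow>
     (nat \<Rightarrow> real) measure \<Rightarrow> bool" where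
  "constrained_law M d p X h \<mu> \<longleftrightarrow>
     (\<exists>\<kappa>. regular_cond_dist M (Rn d) X (Rn p) (\<lambda>\<omega>. h (X \<omega>)) \<kappa> \<and>
          \<mu> = \<kappa> (zero_vec p) \<and> (AE x in \<mu>. h x = zero_vec p))"

definition subvec :: "nat \<Rightarrow> (nat \<Rightarrow> nat) \<Rightarrow> (nat \<Rightarrow> real) \<Rightarrow> nat \<Rightarrow> real" where
  "subvec n w x = (\<lambda>i\<in>{1..n}. x (w i))"

text \<open>
  The function \<open>r\<close> on \<open>\<real>\<^sup>d\<close> is taken on \<open>\<real> \<times> \<real>\<^bsup>d-1\<^esup>\<close>. It has to be measurable, since
  otherwise \<open>r (X\<^sub>j, Z)\<close> would have no distribution. The enumeration \<open>w\<close> of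
  \<open>{1, \<dots>, d} - {j}\<close> fixes the order of the remaining coordinates. Independence
  of \<open>X\<^sub>j\<close> and \<open>Z\<close> is stated for the generated sigma-algebras because \<open>indep_var\<close> needs both
  variables to have values of the same type.
\<close>

definition dependency_model ::
    "'a measure \<Rightarrow> nat \<Rightarrow> ('a \<Rightarrow> nat \<Rightarrow> real) \<Rightarrow> nat \<Rightarrow> (nat \<Rightarrow> nat) \<Rightarrow>
     (real \<times> (nat \<Rightarrow> real) \<Rightarrow> nat \<Rightarrow> real) \<Rightarrow> ('a \<Rightarrow> nat \<Rightarrow> real) \<Rightarrow> bool" where
  "dependency_model N d X j w r Z \<longleftrightarrow>
     X \<in> N \<rightarrow>\<^sub>M Rn d \<and>
     r \<in> borel \<Otimes>\<^sub>M Rn (d - 1) \<rightarrow>\<^sub>M Rn (d - 1) \<and>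
     Z \<in> N \<rightarrow>\<^sub>M Rn (d - 1) \<and>
     prob_space.indep_vars N (\<lambda>_. borel) (\<lambda>i \<omega>. Z \<omega> i) {1..d - 1} \<and>
     prob_space.indep_set N (sets (vimage_algebra (space N) (\<lambda>\<omega>. X \<omega> j) borel))
       (sets (vimage_algebra (space N) Z (Rn (d - 1)))) \<and>
     distr N (Rn (d - 1)) (\<lambda>\<omega>. subvec (d - 1) w (X \<omega>)) =
       distr N (Rn (d - 1)) (\<lambda>\<omega>. r (X \<omega> j, Z \<omega>)) \<and>
     distr N (borel \<Otimes>\<^sub>M Rn (d - 1)) (\<lambda>\<omega>. (X \<omega> j, subvec (d - 1) w (X \<omega>))) =
       distr N (borel \<Otimes>\<^sub>M Rn (d - 1)) (\<lambda>\<omega>. (X \<omega> j, r (X \<omega> j, Z \<omega>)))"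

text \<open>
  \<open>N\<close> extends the probability space \<open>M\<close> by an additional source of randomness in \<open>'b\<close>;
  a random variable \<open>X\<close> on \<open>M\<close> becomes \<open>X \<circ> fst\<close> on \<open>N\<close>.
\<close>

definition extends_prob_space :: "('a \<times> 'b) measure \<Rightarrow> 'a measure \<Rightarrow> bool" where
  "extends_prob_space N M \<longleftrightarrow> prob_space N \<and> fst \<in> N \<rightarrow>\<^sub>M M \<and> distr N M fst = M"

lemma zero_vec_sets: "{zero_vec n} \<in> sets (Rn n)"
proof -
  have eq: "{zero_vec n} = (\<Pi>\<^sub>E i\<in>{1..n}. {0::real})"
    by (auto simp: zero_vec_def PiE_iff extensional_def restrict_def)
  show ?thesis
    unfolding Rn_def eq by (intro sets_PiM_I_finite) auto
qed

lemma constrained_law_elementary: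
  assumes "prob_space M" and X: "X \<in> M \<rightarrow>\<^sub>M Rn d" and h: "h \<in> Rn d \<rightarrow>\<^sub>M Rn p"
    and law: "constrained_law M d p X h \<mu>" and A: "A \<in> sets (Rn d)"
    and pos: "emeasure M {\<omega> \<in> space M. h (X \<omega>) = zero_vec p} \<noteq> 0"
  shows "emeasure \<mu> A = emeasure M {\<omega> \<in> space M. X \<omega> \<in> A \<and> h (X \<omega>) = zero_vec p}
    / emeasure M {\<omega> \<in> space M. h (X \<omega>) = zero_vec p}"
proof -
  interpret prob_space M by fact
  let ?z = "zero_vec p" and ?Y = "\<lambda>\<omega>. h (X \<omega>)"
  let ?D = "distr M (Rn p) ?Y"
  obtain \<kappa> where rcd: "regular_cond_dist M (Rn d) X (Rn p) ?Y \<kappa>" and \<mu>: "\<mu> = \<kappa> ?z"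
    using law unfolding constrained_law_def by blast
  have Y: "?Y \<in> M \<rightarrow>\<^sub>M Rn p"
    using measurable_compose[OF X h] .
  have D: "emeasure ?D {?z} = emeasure M {\<omega> \<in> space M. ?Y \<omega> = ?z}"
    by (subst emeasure_distr[OF Y zero_vec_sets]) (auto intro!: arg_cong[where f = "emeasure M"])
  have "emeasure M {\<omega> \<in> space M. X \<omega> \<in> A \<and> ?Y \<omega> \<in> {?z}} =
      (\<integral>\<^sup>+ y\<in>{?z}. emeasure (\<kappa> y) A \<partial>?D)"
    using rcd A zero_vec_sets unfolding regular_cond_dist_def by blast
  also have "\<dots> = (\<integral>\<^sup>+ y. emeasure \<mu> A * indicator {?z} y \<partial>?D)"
    by (intro nn_integral_cong) (auto simp: \<mu> split: split_indicator)
  also have "\<dots> = emeasure \<mu> A * emeasure ?D {?z}"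
    by (subst nn_integral_cmult_indicator) (auto simp: zero_vec_sets)
  finally have "emeasure M {\<omega> \<in> space M. X \<omega> \<in> A \<and> ?Y \<omega> = ?z} =
      emeasure \<mu> A * emeasure M {\<omega> \<in> space M. ?Y \<omega> = ?z}"
    by (simp add: D)
  then show ?thesis
    using pos by (simp add: ennreal_mult_divide_eq)
qed

end

theory Submission
  imports Defs
begin

text \<open>
  The theorem is an instance of noise outsourcing, which holds for every law \<open>P\<close> on
  \<open>S \<times> \<real>\<^sup>n\<close>: there is a measurable \<open>r\<close> such that \<open>P\<close> is the law of \<open>(x, r (x, Z))\<close>, where \<open>x\<close>
  has the first marginal of \<open>P\<close> and \<open>Z\<close> is independent of \<open>x\<close> and uniform on the cube.
  For \<open>n = 1\<close>, \<open>r (x, _)\<close> is a decreasing conditional quantile function. It is built from Radon-Nikodym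
  densities \<open>G q\<close> of the tail events at rational levels \<open>q\<close> only, so that all almost sure
  monotonicity relations hold outside a single null set. For larger \<open>n\<close> the coordinates are
  generated one after the other, each conditionally on \<open>x\<close> and the previous ones
  (Rosenblatt's construction).
  The extension \<open>N\<close> is the product of \<open>Mc\<close> with the uniform law on the cube.
\<close>

section \<open>Conditional probabilities as bounded densities\<close>

text \<open>Testing the inequality on the set \<open>g < f\<close> where the claim fails makes the
  integral of \<open>f - g\<close> over it vanish, so this set is null. Finiteness of the integral
  of \<open>g\<close> permits the subtraction.\<close>

lemma (in finite_measure) AE_le_if_set_nn_integral_le:
  fixes f g :: "'a \<Rightarrow> ennreal"
  assumes [measurable]: "f \<in> borel_measurable M" "g \<in> borel_measurable M"
    and fin: "(\<integral>\<^sup>+x. g x \<partial>M) < \<infinity>"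
    and le: "\<And>A. A \<in> sets M \<Longrightarrow> (\<integral>\<^sup>+x\<in>A. f x \<partial>M) \<le> (\<integral>\<^sup>+x\<in>A. g x \<partial>M)"
  shows "AE x in M. f x \<le> g x"
proof -
  define A where "A = {x \<in> space M. g x < f x}"
  have A[measurable]: "A \<in> sets M" unfolding A_def by measurable
  have "(\<integral>\<^sup>+x\<in>A. g x \<partial>M) \<le> (\<integral>\<^sup>+x. g x \<partial>M)"
    by (intro nn_integral_mono) (auto split: split_indicator)
  with fin have fin': "(\<integral>\<^sup>+x\<in>A. g x \<partial>M) \<noteq> \<infinity>" by auto
  have "(\<integral>\<^sup>+x. f x * indicator A x - g x * indicator A x \<partial>M) =
      (\<integral>\<^sup>+x\<in>A. f x \<partial>M) - (\<integral>\<^sup>+x\<in>A. g x \<partial>M)"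
    by (rule nn_integral_diff[OF _ _ fin']) (auto simp: A_def split: split_indicator)
  also have "\<dots> = 0"
    using le[OF A] fin' by (simp add: diff_eq_0_iff_ennreal less_top)
  finally have "AE x in M. f x * indicator A x - g x * indicator A x = 0"
    by (subst (asm) nn_integral_0_iff_AE) auto
  with AE_space show ?thesis
  proof eventually_elim
    case (elim x)
    then show ?case
      by (cases "x \<in> A") (auto simp: A_def diff_eq_0_iff_ennreal not_less)
  qed
qed

text \<open>\<open>G\<close> is a version of the conditional probability that the second component
  lies in \<open>B\<close> given the first: a Radon-Nikodym derivative with respect to the first
  marginal. Truncation at 1 turns its almost sure bound into an everywhere one, so that
  \<open>G x\<close> can serve as a threshold for a uniform variable.\<close>

lemma conditional_probability_density:
  assumes "prob_space P" and sets[measurable_cong]: "sets P = sets (S \<Otimes>\<^sub>M T)" and B[measurable]: "B \<in> sets T"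
  obtains G :: "'a \<Rightarrow> real" where "G \<in> borel_measurable S" "\<And>x. 0 \<le> G x" "\<And>x. G x \<le> 1"
    "\<And>A. A \<in> sets S \<Longrightarrow> (\<integral>\<^sup>+x\<in>A. ennreal (G x) \<partial>distr P S fst) = emeasure P (A \<times> B)"
proof -
  interpret P: prob_space P by fact
  let ?\<mu> = "distr P S fst"
  interpret \<mu>: prob_space ?\<mu> by (rule P.prob_space_distr) measurable
  \<comment> \<open>The indicator density keeps the part of \<open>P\<close> with second component
    in \<open>B\<close>; its image under \<open>fst\<close> is therefore dominated by the first
    marginal.\<close>
  define \<nu> where "\<nu> = distr (density P (\<lambda>z. indicator B (snd z))) S fst"
  have \<nu>: "emeasure \<nu> A = emeasure P (A \<times> B)" if [measurable]: "A \<in> sets S" for A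
  proof -
    have "emeasure \<nu> A = (\<integral>\<^sup>+z. indicator B (snd z) * indicator (fst -` A \<inter> space P) z \<partial>P)"
      unfolding \<nu>_def by (subst emeasure_distr) (auto simp: emeasure_density)
    also have "\<dots> = (\<integral>\<^sup>+z. indicator (A \<times> B) z \<partial>P)"
      by (intro nn_integral_cong) (auto split: split_indicator)
    also have "\<dots> = emeasure P (A \<times> B)"
      by (rule nn_integral_indicator) measurable
    finally show ?thesis .
  qed
  have \<mu>: "emeasure ?\<mu> A = emeasure P (A \<times> space T)" if [measurable]: "A \<in> sets S" for A
  proof -
    have "fst -` A \<inter> space P = A \<times> space T"
      using sets.sets_into_space[OF that] sets_eq_imp_space_eq[OF sets]
      by (auto simp: space_pair_measure)
    then show ?thesis by (simp add: emeasure_distr)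
  qed
  have le: "emeasure \<nu> A \<le> emeasure ?\<mu> A" if [measurable]: "A \<in> sets S" for A
    using sets.sets_into_space[OF B] by (auto simp: \<nu> \<mu> intro!: emeasure_mono)
  have ac: "absolutely_continuous ?\<mu> \<nu>"
    unfolding absolutely_continuous_def null_sets_def using le
    by (auto simp: \<nu>_def) (metis le_zero_eq)
  define g where "g = RN_deriv ?\<mu> \<nu>"
  have [measurable]: "g \<in> borel_measurable S" unfolding g_def
    by (metis borel_measurable_RN_deriv measurable_distr_eq1)
  have dens: "density ?\<mu> g = \<nu>"
    unfolding g_def by (rule \<mu>.density_RN_deriv[OF ac]) (simp add: \<nu>_def)
  have int: "(\<integral>\<^sup>+x\<in>A. g x \<partial>?\<mu>) = emeasure P (A \<times> B)" if [measurable]: "A \<in> sets S" for A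
    using that by (simp add: \<nu>[symmetric] dens[symmetric] emeasure_density)
  have AE: "AE x in ?\<mu>. g x \<le> 1"
  proof (rule \<mu>.AE_le_if_set_nn_integral_le)
    fix A assume "A \<in> sets ?\<mu>"
    then show "(\<integral>\<^sup>+x\<in>A. g x \<partial>?\<mu>) \<le> (\<integral>\<^sup>+x\<in>A. 1 \<partial>?\<mu>)"
      using le[of A] by (simp add: int \<nu>[symmetric])
  qed (use \<mu>.emeasure_space_1 in auto)
  show ?thesis
  proof
    show "(\<lambda>x. enn2real (min 1 (g x))) \<in> borel_measurable S" by measurable
    show "0 \<le> enn2real (min 1 (g x))" for x by simp
    show "enn2real (min 1 (g x)) \<le> 1" for x
      by (rule enn2real_leI) auto
    fix A assume A: "A \<in> sets S"
    have "(\<integral>\<^sup>+x\<in>A. ennreal (enn2real (min 1 (g x))) \<partial>?\<mu>) = (\<integral>\<^sup>+x\<in>A. g x \<partial>?\<mu>)"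
      using AE by (intro nn_integral_cong_AE, eventually_elim)
        (auto simp: min_absorb2 less_top[symmetric] top_unique intro!: ennreal_enn2real split: split_indicator)
    then show "(\<integral>\<^sup>+x\<in>A. ennreal (enn2real (min 1 (g x))) \<partial>?\<mu>) = emeasure P (A \<times> B)"
      using int[OF A] by simp
  qed
qed

section \<open>Noise outsourcing for one real coordinate\<close>

text \<open>Such a sequence writes the event of exceeding \<open>t\<close> as an increasing union of
  events at rational levels, where monotonicity is controlled outside one null set.\<close>

lemma decseq_Rats_tendsto:
  obtains q :: "nat \<Rightarrow> real" where "\<And>n. q n \<in> \<rat>" "\<And>n. t < q n" "decseq q" "q \<longlonglongrightarrow> t"
proof -
  \<comment> \<open>The open intervals for consecutive \<open>n\<close> are disjoint and descend to
    \<open>t\<close>, so any rationals chosen in them decrease and converge to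
    \<open>t\<close>.\<close>
  have "\<exists>x\<in>\<rat>. t + 1 / real (n + 2) < x \<and> x < t + 1 / real (n + 1)" for n
    by (rule Rats_dense_in_real) (simp add: field_simps)
  then obtain q where q: "\<And>n. q n \<in> \<rat>" "\<And>n. t + 1 / real (n + 2) < q n" "\<And>n. q n < t + 1 / real (n + 1)"
    by metis
  show ?thesis
  proof
    show "q n \<in> \<rat>" for n by fact
    show gt: "t < q n" for n by (rule less_trans[OF _ q(2)]) simp
    have "(\<lambda>n. t + 1 / real (Suc n)) \<longlonglongrightarrow> t"
      using LIMSEQ_inverse_real_of_nat_add[of t] by (simp add: inverse_eq_divide)
    then show "q \<longlonglongrightarrow> t"
      by (rule real_tendsto_sandwich[OF _ _ tendsto_const, rotated 2])
        (use q(3) gt in \<open>auto intro!: always_eventually less_imp_le\<close>)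
    show "decseq q"
    proof (rule decseq_SucI)
      fix n show "q (Suc n) \<le> q n" using q(2)[of n] q(3)[of "Suc n"] by (simp add: add.commute)
    qed
  qed
qed

definition unit_uniform :: "real measure" where
  "unit_uniform = uniform_measure lborel {0..1}"

lemma sets_unit_uniform[simp, measurable_cong]: "sets unit_uniform = sets borel"
  by (simp add: unit_uniform_def)

lemma space_unit_uniform[simp]: "space unit_uniform = UNIV"
  by (simp add: unit_uniform_def)

lemma prob_space_unit_uniform: "prob_space unit_uniform"
  unfolding unit_uniform_def by (rule prob_space_uniform_measure) auto

lemma emeasure_unit_uniform_lessThan:
  assumes "0 \<le> g" "g \<le> 1"
  shows "emeasure unit_uniform {..<g} = ennreal g"
proof -
  have "{0..1} \<inter> {..<g} = {0..<g}" using assms by auto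
  then show ?thesis using assms by (simp add: unit_uniform_def divide_ennreal flip: ennreal_1)
qed

text \<open>For fixed \<open>A\<close>, a finite measure on the line is determined by its right
  tails. This gives agreement on all rectangles, an intersection-stable generator of the product
  sigma-algebra.\<close>

lemma measure_pair_borel_eqI:
  fixes P Q :: "('s \<times> real) measure"
  assumes "finite_measure P" and sets[measurable_cong]: "sets P = sets (S \<Otimes>\<^sub>M borel)" "sets Q = sets (S \<Otimes>\<^sub>M borel)"
    and eq: "\<And>A t. A \<in> sets S \<Longrightarrow> emeasure P (A \<times> {t<..}) = emeasure Q (A \<times> {t<..})"
  shows "P = Q"
proof -
  interpret P: finite_measure P by fact
  define cut :: "('s \<times> real) measure \<Rightarrow> 's set \<Rightarrow> real measure"
    where "cut R A = distr (density R (\<lambda>z. indicator A (fst z))) borel snd" for R A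
  have cut: "emeasure (cut R A) B = emeasure R (A \<times> B)"
    if R[measurable_cong]: "sets R = sets (S \<Otimes>\<^sub>M borel)" and [measurable]: "A \<in> sets S" "B \<in> sets borel" for R A B
  proof -
    have "emeasure (cut R A) B = (\<integral>\<^sup>+z. indicator A (fst z) * indicator (snd -` B \<inter> space R) z \<partial>R)"
      unfolding cut_def by (subst emeasure_distr) (auto simp: emeasure_density)
    also have "\<dots> = (\<integral>\<^sup>+z. indicator (A \<times> B) z \<partial>R)"
      by (intro nn_integral_cong) (auto split: split_indicator)
    also have "\<dots> = emeasure R (A \<times> B)"
      by (rule nn_integral_indicator) measurable
    finally show ?thesis .
  qed
  have "cut P A = cut Q A" if A: "A \<in> sets S" for A
    by (rule measure_eqI_lessThan)
      (auto simp: cut sets A eq, auto simp: cut_def less_top[symmetric] P.emeasure_finite simp flip: eq[OF A])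
  then have *: "emeasure P (A \<times> B) = emeasure Q (A \<times> B)" if "A \<in> sets S" "B \<in> sets borel" for A B
    using cut[OF sets(1) that] cut[OF sets(2) that] that by simp
  show ?thesis
    by (rule measure_eqI_generator_eq[OF Int_stable_pair_measure_generator[of S borel] pair_measure_closed[of S borel],
          where A = "\<lambda>_. space S \<times> space borel"])
      (auto simp: sets sets_pair_measure *, auto simp: P.emeasure_finite simp flip: *,
        rule exI[of _ "space S"], rule exI[of _ UNIV], simp)
qed

text \<open>Replacing \<open>y\<close> by \<open>arctan y\<close>, which lies in \<open>(-2, 2)\<close>, spares the limits at infinity of
  the conditional distribution function.\<close>

lemma conditional_tail_densities:
  fixes P :: "('s \<times> real) measure"
  assumes "prob_space P" and sets[measurable_cong]: "sets P = sets (S \<Otimes>\<^sub>M borel)"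
  obtains G :: "real \<Rightarrow> 's \<Rightarrow> real" where
    "\<And>q. G q \<in> borel_measurable S" "\<And>q x. 0 \<le> G q x" "\<And>q x. G q x \<le> 1"
    "\<And>q x. q < -2 \<Longrightarrow> G q x = 1" "\<And>q x. 2 \<le> q \<Longrightarrow> G q x = 0"
    "\<And>q A. A \<in> sets S \<Longrightarrow>
      (\<integral>\<^sup>+x\<in>A. ennreal (G q x) \<partial>distr P S fst) = emeasure P (A \<times> {y. q < arctan y})"
proof -
  have bound: "-2 < arctan y" "arctan y < 2" for y
    using arctan_lbound[of y] arctan_ubound[of y] pi_less_4 by auto
  have "\<exists>g. g \<in> borel_measurable S \<and> (\<forall>x. 0 \<le> g x) \<and> (\<forall>x. g x \<le> 1) \<and>
    (q < -2 \<longrightarrow> (\<forall>x. g x = 1)) \<and> (2 \<le> q \<longrightarrow> (\<forall>x. g x = 0)) \<and>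
    (\<forall>A\<in>sets S. (\<integral>\<^sup>+x\<in>A. ennreal (g x) \<partial>distr P S fst) = emeasure P (A \<times> {y. q < arctan y}))" (is "\<exists>g. ?Q q g") for q
  proof -
    \<comment> \<open>Outside \<open>-2 \<le> q < 2\<close> the tail event is everything or nothing,
      so the constants 1 and 0 are exact densities; choosing them makes these values hold at every
      point and not just almost surely.\<close>
    consider "q < -2" | "2 \<le> q" | "-2 \<le> q" "q < 2" by linarith
    then show ?thesis
    proof cases
      case 1
      have "{y. q < arctan y} = UNIV" using 1 bound(1) by (auto intro: less_trans)
      moreover have "fst -` A \<inter> space P = A \<times> UNIV" if "A \<in> sets S" for A
        using sets.sets_into_space[OF that] sets_eq_imp_space_eq[OF sets]
        by (auto simp: space_pair_measure)
      ultimately show ?thesis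
        using 1 by (intro exI[of _ "\<lambda>_. 1"]) (simp add: emeasure_distr)
    next
      case 2
      have "{y. q < arctan y} = {}" using 2 bound(2) by (force dest: order.strict_trans)
      then show ?thesis using 2 by (intro exI[of _ "\<lambda>_. 0"]) simp
    next
      case 3
      have "{y::real. q < arctan y} \<in> sets borel" by measurable
      from conditional_probability_density[OF assms this] obtain g where
        "g \<in> borel_measurable S" "\<And>x. 0 \<le> g x" "\<And>x. g x \<le> 1"
        "\<And>A. A \<in> sets S \<Longrightarrow> (\<integral>\<^sup>+x\<in>A. ennreal (g x) \<partial>distr P S fst) = emeasure P (A \<times> {y. q < arctan y})"
        by blast
      then show ?thesis using 3 by (intro exI[of _ g]) simp
    qed
  qed
  then have "\<exists>G. \<forall>q. ?Q q (G q)"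
    by (intro choice allI)
  then obtain G where G: "\<And>q. ?Q q (G q)" by blast
  show ?thesis
    by (rule that[of G]) (use G in auto)
qed

text \<open>For uniform \<open>u\<close>, the event \<open>u < G q x\<close> has probability
  \<open>G q x\<close>, the conditional probability of exceeding level \<open>q\<close>. Hence the
  supremum of the rational \<open>q\<close> with \<open>u < G q x\<close> has the conditional law of
  \<open>arctan y\<close> given \<open>x\<close>, and \<open>tan\<close> recovers \<open>y\<close>.
  The integral form, for all measurable \<open>f\<close>, is what the induction over coordinates
  consumes.\<close>

lemma noise_outsourcing_real:
  fixes P :: "('s \<times> real) measure"
  assumes "prob_space P" and sets[measurable_cong]: "sets P = sets (S \<Otimes>\<^sub>M borel)"
  shows "\<exists>r \<in> borel_measurable (S \<Otimes>\<^sub>M borel). \<forall>f \<in> borel_measurable (S \<Otimes>\<^sub>M borel).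
    (\<integral>\<^sup>+z. f z \<partial>P) = (\<integral>\<^sup>+x. \<integral>\<^sup>+u. f (x, r (x, u)) \<partial>unit_uniform \<partial>distr P S fst)"
proof -
  interpret P: prob_space P by fact
  let ?\<mu> = "distr P S fst" and ?U = unit_uniform
  interpret \<mu>: prob_space ?\<mu> by (rule P.prob_space_distr) measurable
  interpret U: prob_space ?U by (rule prob_space_unit_uniform)
  obtain G where [measurable]: "\<And>q. G q \<in> borel_measurable S"
    and G0: "\<And>q x. 0 \<le> G q x" and G1: "\<And>q x. G q x \<le> 1"
    and Glow: "\<And>q x. q < -2 \<Longrightarrow> G q x = 1" and Ghigh: "\<And>q x. 2 \<le> q \<Longrightarrow> G q x = 0"
    and Gint: "\<And>q A. A \<in> sets S \<Longrightarrow>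
      (\<integral>\<^sup>+x\<in>A. ennreal (G q x) \<partial>?\<mu>) = emeasure P (A \<times> {y. q < arctan y})"
    using conditional_tail_densities[OF assms] by blast
  have fin: "(\<integral>\<^sup>+x. ennreal (G q x) \<partial>?\<mu>) < \<infinity>" for q
  proof -
    have "(\<integral>\<^sup>+x. ennreal (G q x) \<partial>?\<mu>) \<le> (\<integral>\<^sup>+x. 1 \<partial>?\<mu>)"
      using G1 by (intro nn_integral_mono) (simp add: ennreal_le_1)
    then show ?thesis using \<mu>.emeasure_space_1 by (auto intro: le_less_trans)
  qed
  \<comment> \<open>A higher level has a smaller tail event, so its density has the smaller integral
    over every \<open>A\<close>, hence is almost surely smaller.\<close>
  have "AE x in ?\<mu>. ennreal (G q' x) \<le> ennreal (G q x)" if "q < q'" for q q'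
  proof (rule \<mu>.AE_le_if_set_nn_integral_le[OF _ _ fin])
    fix A assume A: "A \<in> sets ?\<mu>"
    have "A \<times> {y. q < arctan y} \<in> sets P" using A by simp
    then show "(\<integral>\<^sup>+x\<in>A. ennreal (G q' x) \<partial>?\<mu>) \<le> (\<integral>\<^sup>+x\<in>A. ennreal (G q x) \<partial>?\<mu>)"
      using A that by (simp add: Gint) (intro emeasure_mono; force)
  qed auto
  then have antitone: "AE x in ?\<mu>. \<forall>q\<in>\<rat>. \<forall>q'\<in>\<rat>. q < q' \<longrightarrow> G q' x \<le> G q x"
    using G0 by (simp add: AE_ball_countable countable_rat AE_impI)
  define H where "H q x u \<longleftrightarrow> q < -2 \<or> (q < 2 \<and> u < G q x)" for q u :: real and x :: 's
  have H_meas[measurable]: "{z \<in> space (S \<Otimes>\<^sub>M borel). H q (fst z) (snd z)} \<in> sets (S \<Otimes>\<^sub>M borel)" for q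
    unfolding H_def by measurable
  text \<open>The clause \<open>q < -2\<close> keeps the set below nonempty, \<open>q < 2\<close> keeps it bounded.\<close>
  define r\<^sub>0 where "r\<^sub>0 z = Sup {q \<in> \<rat>. H q (fst z) (snd z)}" for z
  have r0_iff: "t < r\<^sub>0 z \<longleftrightarrow> (\<exists>q\<in>\<rat>. t < q \<and> H q (fst z) (snd z))" for t z
  proof -
    have "-3 \<in> {q \<in> \<rat>. H q (fst z) (snd z)}" by (simp add: H_def)
    then have "{q \<in> \<rat>. H q (fst z) (snd z)} \<noteq> {}" by blast
    moreover have "bdd_above {q \<in> \<rat>. H q (fst z) (snd z)}"
      by (rule bdd_aboveI[of _ 2]) (auto simp: H_def)
    ultimately show ?thesis
      unfolding r\<^sub>0_def by (subst less_cSup_iff) auto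
  qed
  have [measurable]: "r\<^sub>0 \<in> borel_measurable (S \<Otimes>\<^sub>M borel)"
    unfolding borel_measurable_iff_greater
  proof
    fix t
    have "{z \<in> space (S \<Otimes>\<^sub>M borel). t < r\<^sub>0 z} =
        (\<Union>q\<in>{q \<in> \<rat>. t < q}. {z \<in> space (S \<Otimes>\<^sub>M borel). H q (fst z) (snd z)})"
      by (auto simp: r0_iff)
    also have "\<dots> \<in> sets (S \<Otimes>\<^sub>M borel)"
      by (intro sets.countable_UN'' countable_subset[OF _ countable_rat]) auto
    finally show "{z \<in> space (S \<Otimes>\<^sub>M borel). t < r\<^sub>0 z} \<in> sets (S \<Otimes>\<^sub>M borel)" .
  qed
  \<comment> \<open>The clauses added to \<open>H\<close> agree with the constant values of
    \<open>G\<close> at extreme levels, so the probability is exact for every \<open>q\<close> and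
    \<open>x\<close>.\<close>
  have H_prob: "emeasure ?U {u. H q x u} = ennreal (G q x)" for q x
  proof -
    consider "q < -2" | "2 \<le> q" | "-2 \<le> q" "q < 2" by linarith
    then show ?thesis
    proof cases
      case 1
      then show ?thesis using U.emeasure_space_1 by (simp add: H_def Glow)
    next
      case 2
      then show ?thesis by (simp add: H_def Ghigh)
    next
      case 3
      then have "{u. H q x u} = {..<G q x}" by (auto simp: H_def)
      then show ?thesis by (simp add: emeasure_unit_uniform_lessThan G0 G1)
    qed
  qed
  let ?A = "\<lambda>z. (fst z, arctan (snd z))" and ?B = "\<lambda>z. (fst z, r\<^sub>0 z)"
  interpret \<mu>U: pair_prob_space ?\<mu> ?U ..
  have "distr P (S \<Otimes>\<^sub>M borel) ?A = distr (?\<mu> \<Otimes>\<^sub>M ?U) (S \<Otimes>\<^sub>M borel) ?B"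
  proof (rule measure_pair_borel_eqI[where S = S])
    show "finite_measure (distr P (S \<Otimes>\<^sub>M borel) ?A)"
      by (rule P.finite_measure_distr) measurable
    fix A and t :: real assume A[measurable]: "A \<in> sets S"
    obtain q where qR: "\<And>n. q n \<in> \<rat>" and tq: "\<And>n. t < q n" and dec: "decseq q" and lim: "q \<longlonglongrightarrow> t"
      using decseq_Rats_tendsto[of t] by blast
    have gt_iff: "(\<exists>n. q n < y) \<longleftrightarrow> t < y" for y
      using tq order_tendstoD(2)[OF lim, of y] by (auto simp: eventually_sequentially intro: less_trans)
    have AE_mono: "AE x in ?\<mu>. \<forall>m n. m \<le> n \<longrightarrow> G (q m) x \<le> G (q n) x"
      using antitone
    proof eventually_elim
      case (elim x)
      show ?case
      proof (intro allI impI)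
        fix m n :: nat assume "m \<le> n"
        then have "q n < q m \<or> q n = q m" using decseqD[OF dec] by (auto simp: less_le)
        then show "G (q m) x \<le> G (q n) x" using elim qR by auto
      qed
    qed
    have "emeasure (distr (?\<mu> \<Otimes>\<^sub>M ?U) (S \<Otimes>\<^sub>M borel) ?B) (A \<times> {t<..}) =
        (\<integral>\<^sup>+z. indicator (A \<times> {t<..}) (?B z) \<partial>(?\<mu> \<Otimes>\<^sub>M ?U))"
      by (simp add: nn_integral_distr flip: nn_integral_indicator)
    also have "\<dots> = (\<integral>\<^sup>+x. \<integral>\<^sup>+u. indicator (A \<times> {t<..}) (x, r\<^sub>0 (x, u)) \<partial>?U \<partial>?\<mu>)"
      by (subst U.nn_integral_fst[symmetric]) auto
    \<comment> \<open>For almost every \<open>x\<close> the events \<open>H (q n) x u\<close>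
      increase to \<open>t < r\<^sub>0 (x, u)\<close>, so continuity from below gives the inner
      integral as a supremum.\<close>
    also have "\<dots> = (\<integral>\<^sup>+x. (SUP n. ennreal (G (q n) x) * indicator A x) \<partial>?\<mu>)"
    proof (rule nn_integral_cong_AE)
      show "AE x in ?\<mu>. (\<integral>\<^sup>+u. indicator (A \<times> {t<..}) (x, r\<^sub>0 (x, u)) \<partial>?U) = (SUP n. ennreal (G (q n) x) * indicator A x)"
        using antitone AE_mono AE_space
      proof eventually_elim
        case (elim x)
        then have x: "x \<in> space S" by simp
        have H_mono: "H a x u" if "H b x u" "a \<le> b" "a \<in> \<rat>" "b \<in> \<rat>" for a b u
        proof (cases "a = b")
          case False
          then have "G b x \<le> G a x" using elim(1) that by auto
          then show ?thesis using that by (auto simp: H_def)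
        qed (use that in simp)
        have Un: "{u. t < r\<^sub>0 (x, u)} = (\<Union>n. {u. H (q n) x u})"
        proof safe
          fix u assume "t < r\<^sub>0 (x, u)"
          then obtain b where b: "b \<in> \<rat>" "t < b" "H b x u" by (auto simp: r0_iff)
          \<comment> \<open>A level \<open>b\<close> that witnesses
            \<open>t < r\<^sub>0 (x, u)\<close> lies above some \<open>q n\<close>, and
            \<open>H\<close> passes down to this lower rational level.\<close>
          then obtain n where "q n < b" using gt_iff by blast
          with b qR H_mono show "u \<in> (\<Union>n. {u. H (q n) x u})"
            by (auto intro!: exI[of _ n] H_mono[OF b(3)])
        next
          fix u n assume "H (q n) x u"
          then show "t < r\<^sub>0 (x, u)" using qR tq by (auto simp: r0_iff)
        qed
        have inc: "incseq (\<lambda>n. {u. H (q n) x u})"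
          using qR decseqD[OF dec] by (auto simp: incseq_def intro: H_mono)
        have [measurable]: "{u. H (q n) x u} \<in> sets borel" for n
          unfolding H_def by measurable
        have "(\<integral>\<^sup>+u. indicator (A \<times> {t<..}) (x, r\<^sub>0 (x, u)) \<partial>?U) =
            (\<integral>\<^sup>+u. indicator A x * indicator {u. t < r\<^sub>0 (x, u)} u \<partial>?U)"
          by (intro nn_integral_cong) (auto split: split_indicator)
        also have "\<dots> = indicator A x * emeasure ?U {u. t < r\<^sub>0 (x, u)}"
          unfolding Un by (rule nn_integral_cmult_indicator) measurable
        also have "emeasure ?U {u. t < r\<^sub>0 (x, u)} = (SUP n. ennreal (G (q n) x))"
          unfolding Un by (subst SUP_emeasure_incseq[symmetric]) (auto simp: inc H_prob)
        also have "indicator A x * (SUP n. ennreal (G (q n) x)) = (SUP n. ennreal (G (q n) x) * indicator A x)"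
          by (simp add: SUP_mult_left_ennreal mult.commute)
        finally show ?case .
      qed
    qed
    \<comment> \<open>Monotone convergence takes the supremum out of the integral; the densities
      then turn into probabilities under \<open>P\<close>, and continuity from below reassembles the
      event \<open>t < arctan y\<close>.\<close>
    also have "\<dots> = (SUP n. \<integral>\<^sup>+x. ennreal (G (q n) x) * indicator A x \<partial>?\<mu>)"
    proof (rule nn_integral_monotone_convergence_SUP_AE)
      show "AE x in ?\<mu>. ennreal (G (q n) x) * indicator A x \<le> ennreal (G (q (Suc n)) x) * indicator A x" for n
        using AE_mono by eventually_elim (auto intro!: mult_right_mono ennreal_leI)
    qed measurable
    also have "\<dots> = (SUP n. emeasure P (A \<times> {y. q n < arctan y}))"
      by (simp add: Gint)
    also have "\<dots> = emeasure P (\<Union>n. A \<times> {y. q n < arctan y})"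
    proof (rule SUP_emeasure_incseq)
      show "range (\<lambda>n. A \<times> {y. q n < arctan y}) \<subseteq> sets P" by auto
      show "incseq (\<lambda>n. A \<times> {y. q n < arctan y})"
        using decseqD[OF dec] by (fastforce simp: incseq_def intro: le_less_trans)
    qed
    also have "(\<Union>n. A \<times> {y. q n < arctan y}) = ?A -` (A \<times> {t<..}) \<inter> space P"
      using sets.sets_into_space[OF A] sets_eq_imp_space_eq[OF sets]
      by (auto simp: space_pair_measure simp flip: gt_iff)
    also have "emeasure P \<dots> = emeasure (distr P (S \<Otimes>\<^sub>M borel) ?A) (A \<times> {t<..})"
      by (subst emeasure_distr) auto
    finally show "emeasure (distr P (S \<Otimes>\<^sub>M borel) ?A) (A \<times> {t<..}) =
      emeasure (distr (?\<mu> \<Otimes>\<^sub>M ?U) (S \<Otimes>\<^sub>M borel) ?B) (A \<times> {t<..})" ..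
  qed auto
  note law = this
  have [measurable]: "tan \<in> borel_measurable (borel :: real measure)"
    unfolding tan_def by measurable
  show ?thesis
  proof (intro bexI ballI)
    \<comment> \<open>\<open>tan\<close> inverts \<open>arctan\<close> at every real. Being total,
      it can be composed with \<open>r\<^sub>0\<close> even where \<open>r\<^sub>0\<close> leaves
      the range of \<open>arctan\<close>.\<close>
    show "(\<lambda>z. tan (r\<^sub>0 z)) \<in> borel_measurable (S \<Otimes>\<^sub>M borel)" by measurable
    fix f :: "'s \<times> real \<Rightarrow> ennreal" assume [measurable]: "f \<in> borel_measurable (S \<Otimes>\<^sub>M borel)"
    have "(\<integral>\<^sup>+z. f z \<partial>P) = (\<integral>\<^sup>+z. f (fst z, tan (snd z)) \<partial>distr P (S \<Otimes>\<^sub>M borel) ?A)"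
      by (subst nn_integral_distr) (auto simp: tan_arctan)
    also have "\<dots> = (\<integral>\<^sup>+z. f (fst z, tan (r\<^sub>0 z)) \<partial>(?\<mu> \<Otimes>\<^sub>M ?U))"
      unfolding law by (subst nn_integral_distr) auto
    also have "\<dots> = (\<integral>\<^sup>+x. \<integral>\<^sup>+u. f (x, tan (r\<^sub>0 (x, u))) \<partial>?U \<partial>?\<mu>)"
      by (subst U.nn_integral_fst[symmetric]) auto
    finally show "(\<integral>\<^sup>+z. f z \<partial>P) = (\<integral>\<^sup>+x. \<integral>\<^sup>+u. f (x, tan (r\<^sub>0 (x, u))) \<partial>?U \<partial>?\<mu>)" .
  qed
qed

section \<open>Noise outsourcing for several coordinates\<close>

definition uniform_cube :: "nat \<Rightarrow> (nat \<Rightarrow> real) measure" where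
  "uniform_cube n = (\<Pi>\<^sub>M i\<in>{1..n}. unit_uniform)"

lemma sets_uniform_cube[measurable_cong]: "sets (uniform_cube n) = sets (Rn n)"
  unfolding Rn_def uniform_cube_def by (intro sets_PiM_cong) auto

lemma prob_space_uniform_cube: "prob_space (uniform_cube n)"
  unfolding uniform_cube_def by (intro prob_space_PiM prob_space_unit_uniform)

lemma Rn_Suc: "Rn (Suc n) = (\<Pi>\<^sub>M i\<in>insert (Suc n) {1..n}. borel)"
  by (simp add: Rn_def atLeastAtMostSuc_conv)

text \<open>Induction on \<open>n\<close> with arbitrary law: the induction hypothesis generates the
  first \<open>n\<close> coordinates from \<open>x\<close>; together with \<open>x\<close> they form
  a point of the base space \<open>S \<Otimes>\<^sub>M Rn n\<close>, from which the one-dimensional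
  result generates the last coordinate.\<close>

lemma noise_outsourcing:
  fixes P :: "('s \<times> (nat \<Rightarrow> real)) measure"
  assumes "prob_space P" and "sets P = sets (S \<Otimes>\<^sub>M Rn n)"
  shows "\<exists>r \<in> S \<Otimes>\<^sub>M Rn n \<rightarrow>\<^sub>M Rn n. \<forall>f \<in> borel_measurable (S \<Otimes>\<^sub>M Rn n).
    (\<integral>\<^sup>+z. f z \<partial>P) = (\<integral>\<^sup>+x. \<integral>\<^sup>+z. f (x, r (x, z)) \<partial>uniform_cube n \<partial>distr P S fst)"
  using assms
proof (induction n arbitrary: P)
  case 0
  note [measurable_cong] = 0(2)
  interpret U: prob_space "uniform_cube 0" by (rule prob_space_uniform_cube)
  show ?case
  proof (intro bexI ballI)
    \<comment> \<open>\<open>Rn 0\<close> has a single point, the everywhere undefined function, so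
      nothing has to be generated and \<open>snd\<close> returns that point.\<close>
    show "snd \<in> S \<Otimes>\<^sub>M Rn 0 \<rightarrow>\<^sub>M Rn 0" by measurable
    fix f :: "'s \<times> (nat \<Rightarrow> real) \<Rightarrow> ennreal" assume [measurable]: "f \<in> borel_measurable (S \<Otimes>\<^sub>M Rn 0)"
    have sp: "space (uniform_cube 0) = {\<lambda>_. undefined}" "space (Rn 0) = {\<lambda>_. undefined}"
      by (auto simp: space_PiM Rn_def uniform_cube_def)
    have "(\<integral>\<^sup>+z. f (x, snd (x, z)) \<partial>uniform_cube 0) = f (x, \<lambda>_. undefined)" for x
    proof -
      have "(\<integral>\<^sup>+z. f (x, snd (x, z)) \<partial>uniform_cube 0) = (\<integral>\<^sup>+z. f (x, \<lambda>_. undefined) \<partial>uniform_cube 0)"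
        by (intro nn_integral_cong) (unfold sp, simp)
      then show ?thesis using U.emeasure_space_1 by simp
    qed
    moreover have "(\<integral>\<^sup>+z. f z \<partial>P) = (\<integral>\<^sup>+z. f (fst z, \<lambda>_. undefined) \<partial>P)"
      by (intro nn_integral_cong) (auto simp: sets_eq_imp_space_eq[OF 0(2)] space_pair_measure sp)
    moreover have "(\<lambda>_. undefined) \<in> space (Rn 0)" by (simp add: sp)
    ultimately show "(\<integral>\<^sup>+z. f z \<partial>P) =
        (\<integral>\<^sup>+x. \<integral>\<^sup>+z. f (x, snd (x, z)) \<partial>uniform_cube 0 \<partial>distr P S fst)"
      by (subst nn_integral_distr) auto
  qed
next
  case (Suc n)
  note [measurable_cong] = Suc.prems(2)
  interpret P: prob_space P by (rule Suc.prems)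
  define I where "I = {1..n}"
  \<comment> \<open>The last coordinate is split off, so that \<open>x\<close> with the first
    \<open>n\<close> coordinates becomes the conditioning variable.\<close>
  let ?\<phi> = "\<lambda>p. ((fst p, restrict (snd p) I), snd p (Suc n))"
  have [measurable]: "(\<lambda>y. restrict y I) \<in> Rn (Suc n) \<rightarrow>\<^sub>M Rn n"
    unfolding Rn_Suc unfolding Rn_def I_def by (rule measurable_restrict_subset) auto
  have [measurable]: "(\<lambda>y. y (Suc n)) \<in> borel_measurable (Rn (Suc n))"
    unfolding Rn_Suc by measurable
  have upd[measurable]: "(\<lambda>w. (g w)(Suc n := h w)) \<in> T \<rightarrow>\<^sub>M Rn (Suc n)"
    if "g \<in> T \<rightarrow>\<^sub>M Rn n" "h \<in> borel_measurable T" for g h and T :: "'t measure"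
    using that unfolding Rn_Suc unfolding Rn_def
    by (intro measurable_fun_upd[where J = "{1..n}"]) auto
  define Q where "Q = distr P ((S \<Otimes>\<^sub>M Rn n) \<Otimes>\<^sub>M borel) ?\<phi>"
  have Q: "prob_space Q" unfolding Q_def by (rule P.prob_space_distr) measurable
  have setsQ: "sets Q = sets ((S \<Otimes>\<^sub>M Rn n) \<Otimes>\<^sub>M borel)" by (simp add: Q_def)
  note [measurable_cong] = setsQ
  obtain s where s[measurable]: "s \<in> borel_measurable ((S \<Otimes>\<^sub>M Rn n) \<Otimes>\<^sub>M borel)"
    and s_int: "\<And>f. f \<in> borel_measurable ((S \<Otimes>\<^sub>M Rn n) \<Otimes>\<^sub>M borel) \<Longrightarrow>
      (\<integral>\<^sup>+z. f z \<partial>Q) = (\<integral>\<^sup>+w. \<integral>\<^sup>+u. f (w, s (w, u)) \<partial>unit_uniform \<partial>distr Q (S \<Otimes>\<^sub>M Rn n) fst)"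
    using noise_outsourcing_real[OF Q setsQ] by (elim bexE) (rule that, simp_all)
  define P' where "P' = distr Q (S \<Otimes>\<^sub>M Rn n) fst"
  have P': "prob_space P'" unfolding P'_def
    by (rule prob_space.prob_space_distr[OF Q]) measurable
  obtain r where r[measurable]: "r \<in> S \<Otimes>\<^sub>M Rn n \<rightarrow>\<^sub>M Rn n"
    and r_int: "\<And>f. f \<in> borel_measurable (S \<Otimes>\<^sub>M Rn n) \<Longrightarrow>
      (\<integral>\<^sup>+z. f z \<partial>P') = (\<integral>\<^sup>+x. \<integral>\<^sup>+z. f (x, r (x, z)) \<partial>uniform_cube n \<partial>distr P' S fst)"
  proof -
    have "sets P' = sets (S \<Otimes>\<^sub>M Rn n)" by (simp add: P'_def)
    from Suc.IH[OF P' this] show ?thesis by (elim bexE) (rule that, simp_all)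
  qed
  have \<mu>: "distr P' S fst = distr P S fst"
    unfolding P'_def Q_def by (simp add: distr_distr comp_def)
  interpret U: prob_space unit_uniform by (rule prob_space_unit_uniform)
  interpret V: prob_space "uniform_cube n" by (rule prob_space_uniform_cube)
  interpret prod: product_sigma_finite "\<lambda>_::nat. unit_uniform" ..
  \<comment> \<open>The first \<open>n\<close> noise coordinates go through \<open>r\<close>; the
    last one goes through \<open>s\<close>, conditionally on \<open>x\<close> and the vector just
    generated.\<close>
  define R where "R p = (let w = (fst p, r (fst p, restrict (snd p) I))
    in (snd w)(Suc n := s (w, snd p (Suc n))))" for p
  have R[measurable]: "R \<in> S \<Otimes>\<^sub>M Rn (Suc n) \<rightarrow>\<^sub>M Rn (Suc n)"
    unfolding R_def Let_def by measurable
  show ?case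
  proof (intro bexI[OF _ R] ballI)
    fix f :: "'s \<times> (nat \<Rightarrow> real) \<Rightarrow> ennreal" assume f[measurable]: "f \<in> borel_measurable (S \<Otimes>\<^sub>M Rn (Suc n))"
    \<comment> \<open>\<open>g\<close> is \<open>f\<close> after undoing the regrouping
      \<open>?\<phi>\<close>; the two cancel on \<open>space P\<close> because its vectors are
      extensional.\<close>
    define g where "g p = f (fst (fst p), (snd (fst p))(Suc n := snd p))" for p
    have g[measurable]: "g \<in> borel_measurable ((S \<Otimes>\<^sub>M Rn n) \<Otimes>\<^sub>M borel)"
      unfolding g_def by measurable
    have "(\<integral>\<^sup>+z. f z \<partial>P) = (\<integral>\<^sup>+z. g (?\<phi> z) \<partial>P)"
    proof (rule nn_integral_cong)
      fix z assume "z \<in> space P"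
      then have "snd z \<in> space (Rn (Suc n))"
        by (auto simp: sets_eq_imp_space_eq[OF Suc.prems(2)] space_pair_measure)
      then have "(restrict (snd z) I)(Suc n := snd z (Suc n)) = snd z"
        by (auto simp: I_def Rn_def space_PiM fun_eq_iff PiE_def extensional_def)
      then show "f z = g (?\<phi> z)" by (simp add: g_def)
    qed
    also have "\<dots> = (\<integral>\<^sup>+z. g z \<partial>Q)"
      unfolding Q_def by (subst nn_integral_distr) auto
    also have "\<dots> = (\<integral>\<^sup>+w. \<integral>\<^sup>+u. g (w, s (w, u)) \<partial>unit_uniform \<partial>P')"
      unfolding P'_def by (rule s_int[OF g])
    also have "\<dots> = (\<integral>\<^sup>+x. \<integral>\<^sup>+z. \<integral>\<^sup>+u. g ((x, r (x, z)), s ((x, r (x, z)), u))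
        \<partial>unit_uniform \<partial>uniform_cube n \<partial>distr P S fst)"
      unfolding \<mu>[symmetric] by (rule r_int) measurable
    also have "\<dots> = (\<integral>\<^sup>+x. \<integral>\<^sup>+z. f (x, R (x, z)) \<partial>uniform_cube (Suc n) \<partial>distr P S fst)"
    proof (rule nn_integral_cong)
      fix x assume "x \<in> space (distr P S fst)"
      then have [simp]: "x \<in> space S" by simp
      have "(\<lambda>z. f (x, R (x, z))) \<in> borel_measurable (uniform_cube (Suc n))" by measurable
      \<comment> \<open>The cube measure is the product of the \<open>n\<close>-dimensional one with
        a further uniform coordinate, so Fubini separates \<open>u\<close>.\<close>
      then have "(\<integral>\<^sup>+z. f (x, R (x, z)) \<partial>uniform_cube (Suc n)) =
          (\<integral>\<^sup>+z. \<integral>\<^sup>+u. f (x, R (x, z(Suc n := u))) \<partial>unit_uniform \<partial>uniform_cube n)"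
        unfolding uniform_cube_def atLeastAtMostSuc_conv[OF le_add1[of 1 n, unfolded plus_1_eq_Suc]]
        by (intro prod.product_nn_integral_insert) auto
      also have "\<dots> = (\<integral>\<^sup>+z. \<integral>\<^sup>+u. g ((x, r (x, z)), s ((x, r (x, z)), u)) \<partial>unit_uniform \<partial>uniform_cube n)"
      proof (intro nn_integral_cong)
        fix z u assume "z \<in> space (uniform_cube n)"
        then have "restrict (z(Suc n := u)) I = z"
          by (auto simp: I_def uniform_cube_def space_PiM fun_eq_iff PiE_def extensional_def)
        then show "f (x, R (x, z(Suc n := u))) = g ((x, r (x, z)), s ((x, r (x, z)), u))"
          by (simp add: R_def g_def)
      qed
      finally show "(\<integral>\<^sup>+z. \<integral>\<^sup>+u. g ((x, r (x, z)), s ((x, r (x, z)), u)) \<partial>unit_uniform \<partial>uniform_cube n) =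
        (\<integral>\<^sup>+z. f (x, R (x, z)) \<partial>uniform_cube (Suc n))" ..
    qed
    finally show "(\<integral>\<^sup>+z. f z \<partial>P) =
      (\<integral>\<^sup>+x. \<integral>\<^sup>+z. f (x, R (x, z)) \<partial>uniform_cube (Suc n) \<partial>distr P S fst)" .
  qed
qed

section \<open>Independence of the noise\<close>

lemma (in pair_prob_space) distr_snd: "distr (M1 \<Otimes>\<^sub>M M2) M2 snd = M2"
proof (rule measure_eqI)
  fix A assume "A \<in> sets (distr (M1 \<Otimes>\<^sub>M M2) M2 snd)"
  then have A: "A \<in> sets M2" by simp
  then have "snd -` A \<inter> space (M1 \<Otimes>\<^sub>M M2) = space M1 \<times> A"
    using sets.sets_into_space by (auto simp: space_pair_measure)
  with A show "emeasure (distr (M1 \<Otimes>\<^sub>M M2) M2 snd) A = emeasure M2 A"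
    by (simp add: emeasure_distr M2.emeasure_pair_measure_Times M1.emeasure_space_1)
qed simp

text \<open>Events of the two sigma-algebras are rectangles \<open>A' \<times> space M2\<close> and
  \<open>space M1 \<times> B\<close>; they meet in \<open>A' \<times> B\<close>, whose product
  measure factorizes.\<close>

lemma (in pair_prob_space) indep_set_fst_snd:
  assumes "f \<in> M1 \<rightarrow>\<^sub>M S"
  shows "prob_space.indep_set (M1 \<Otimes>\<^sub>M M2)
    (sets (vimage_algebra (space (M1 \<Otimes>\<^sub>M M2)) (\<lambda>\<omega>. f (fst \<omega>)) S))
    (sets (vimage_algebra (space (M1 \<Otimes>\<^sub>M M2)) snd M2))"
proof -
  let ?N = "M1 \<Otimes>\<^sub>M M2"
  note [measurable] = assms
  show ?thesis
    unfolding P.indep_sets2_eq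
  proof (intro conjI ballI)
    show "sets (vimage_algebra (space ?N) (\<lambda>\<omega>. f (fst \<omega>)) S) \<subseteq> P.events"
      by (rule sets_image_in_sets) auto
    show "sets (vimage_algebra (space ?N) snd M2) \<subseteq> P.events"
      by (rule sets_image_in_sets) auto
    fix a b
    assume "a \<in> sets (vimage_algebra (space ?N) (\<lambda>\<omega>. f (fst \<omega>)) S)"
      and "b \<in> sets (vimage_algebra (space ?N) snd M2)"
    moreover have "(\<lambda>\<omega>. f (fst \<omega>)) \<in> space ?N \<rightarrow> space S" "snd \<in> space ?N \<rightarrow> space M2"
      using measurable_space[OF assms] by (auto simp: space_pair_measure)
    ultimately obtain A B where AB: "A \<in> sets S" "B \<in> sets M2"
      and a: "a = (\<lambda>\<omega>. f (fst \<omega>)) -` A \<inter> space ?N" and b: "b = snd -` B \<inter> space ?N"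
      by (auto simp: sets_vimage_algebra2)
    define A' where "A' = f -` A \<inter> space M1"
    have A': "A' \<in> sets M1" unfolding A'_def using AB by measurable
    have sub: "A' \<subseteq> space M1" "B \<subseteq> space M2"
      using sets.sets_into_space A' AB by auto
    have eqs: "a = A' \<times> space M2" "b = space M1 \<times> B" "a \<inter> b = A' \<times> B"
      using sub by (auto simp: a b A'_def space_pair_measure)
    show "P.prob (a \<inter> b) = P.prob a * P.prob b"
      unfolding eqs(3) unfolding eqs(1,2) using A' AB
      by (simp add: measure_def M2.emeasure_pair_measure_Times enn2real_mult
          M1.emeasure_space_1 M2.emeasure_space_1)
  qed
qed

text \<open>Independence amounts to the joint law being the product of the marginal laws; here both
  are the uniform law on the cube, each coordinate being uniform on the unit interval.\<close>

lemma indep_vars_uniform_cube: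
  assumes "prob_space N" and [measurable]: "Z \<in> N \<rightarrow>\<^sub>M Rn n"
    and Z: "distr N (uniform_cube n) Z = uniform_cube n"
  shows "prob_space.indep_vars N (\<lambda>_. borel) (\<lambda>i \<omega>. Z \<omega> i) {1..n}"
proof -
  interpret N: prob_space N by fact
  have Z_cube: "Z \<in> N \<rightarrow>\<^sub>M uniform_cube n"
    using assms(2) by (simp only: measurable_cong_sets[OF refl sets_uniform_cube])
  show ?thesis
  proof (cases "n = 0")
    \<comment> \<open>An empty family is independent by definition; the criterion through the joint
      law is applied to a nonempty index set.\<close>
    case True
    then show ?thesis by (simp add: N.indep_vars_def N.indep_sets_def)
  next
    case False
    have Zi[measurable]: "(\<lambda>\<omega>. Z \<omega> i) \<in> borel_measurable N" if "i \<in> {1..n}" for i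
      using measurable_compose[OF assms(2), of "\<lambda>z. z i" borel] that
      unfolding Rn_def by simp
    have comp: "distr N borel (\<lambda>\<omega>. Z \<omega> i) = unit_uniform" if i: "i \<in> {1..n}" for i
    proof -
      have "distr N borel (\<lambda>\<omega>. Z \<omega> i) = distr (distr N (uniform_cube n) Z) unit_uniform (\<lambda>z. z i)"
        by (subst distr_distr) (use i Z_cube in \<open>auto simp: uniform_cube_def comp_def intro!: distr_cong\<close>)
      also have "\<dots> = unit_uniform"
        unfolding Z using i unfolding uniform_cube_def by (intro distr_PiM_component prob_space_unit_uniform) auto
      finally show ?thesis .
    qed
    have "distr N (\<Pi>\<^sub>M i\<in>{1..n}. borel) (\<lambda>\<omega>. \<lambda>i\<in>{1..n}. Z \<omega> i) = distr N (uniform_cube n) Z"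
    proof (rule distr_cong)
      show "sets (\<Pi>\<^sub>M i\<in>{1..n}. borel) = sets (uniform_cube n)"
        by (simp only: sets_uniform_cube Rn_def)
      fix \<omega> assume "\<omega> \<in> space N"
      then have "Z \<omega> \<in> space (Rn n)" using measurable_space[OF assms(2)] by blast
      then show "(\<lambda>i\<in>{1..n}. Z \<omega> i) = Z \<omega>"
        by (auto simp: Rn_def space_PiM PiE_def extensional_restrict)
    qed simp
    also have "\<dots> = (\<Pi>\<^sub>M i\<in>{1..n}. distr N borel (\<lambda>\<omega>. Z \<omega> i))"
      unfolding Z unfolding uniform_cube_def by (rule PiM_cong) (simp_all only: comp)
    finally show ?thesis
      using False by (subst N.indep_vars_iff_distr_eq_PiM') auto
  qed
qed

section \<open>Dependency model of the constrained vector\<close>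

theorem corollary1:
  fixes M :: "'a measure" and X :: "'a \<Rightarrow> nat \<Rightarrow> real"
    and Mc :: "'b measure" and Xc :: "'b \<Rightarrow> nat \<Rightarrow> real"
    and h :: "(nat \<Rightarrow> real) \<Rightarrow> nat \<Rightarrow> real"
    and d p j :: nat and w :: "nat \<Rightarrow> nat"
  assumes "p \<le> d" and "h \<in> Rn d \<rightarrow>\<^sub>M Rn p"
    and "prob_space M" and "X \<in> M \<rightarrow>\<^sub>M Rn d"
    and continuous: "\<forall>i\<in>{1..d}. continuous_on UNIV (cdf (distr M borel (\<lambda>\<omega>. X \<omega> i)))"
    and compatible: "\<exists>x\<in>space (Rn d). h x = zero_vec p"
    and "prob_space Mc" and "Xc \<in> Mc \<rightarrow>\<^sub>M Rn d"
    and constrained: "constrained_law M d p X h (distr Mc (Rn d) Xc)"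
    and nondegenerate: "\<not> degenerate_cdf d (joint_cdf d (distr Mc (Rn d) Xc))"
    and "j \<in> {1..d}" and "bij_betw w {1..d - 1} ({1..d} - {j})"
  shows "\<exists>r (N :: ('b \<times> (nat \<Rightarrow> real)) measure) Z.
    extends_prob_space N Mc \<and> dependency_model N d (Xc \<circ> fst) j w r Z"
proof -
  interpret Mc: prob_space Mc by fact
  define n where "n = d - 1"
  let ?V = "uniform_cube n"
  interpret V: prob_space ?V by (rule prob_space_uniform_cube)
  interpret N: pair_prob_space Mc ?V ..
  \<comment> \<open>The noise \<open>Z\<close> will be the second projection, hence independent of
    every variable that lives on \<open>Mc\<close>.\<close>
  define N where "N = Mc \<Otimes>\<^sub>M ?V"
  note Xc[measurable] = \<open>Xc \<in> Mc \<rightarrow>\<^sub>M Rn d\<close>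
  have [measurable]: "(\<lambda>\<omega>. Xc \<omega> i) \<in> borel_measurable Mc" if "i \<in> {1..d}" for i
    using measurable_compose[OF Xc, of "\<lambda>x. x i" borel] that unfolding Rn_def by simp
  note Xj[measurable] = this[OF \<open>j \<in> {1..d}\<close>]
  have w: "w i \<in> {1..d}" if "i \<in> {1..n}" for i
    using bij_betwE[OF \<open>bij_betw w _ _\<close>] that by (auto simp: n_def)
  define Y where "Y \<omega> = subvec n w (Xc \<omega>)" for \<omega>
  have Y[measurable]: "Y \<in> Mc \<rightarrow>\<^sub>M Rn n"
    unfolding Y_def subvec_def Rn_def using w by (intro measurable_restrict) auto
  define P where "P = distr Mc (borel \<Otimes>\<^sub>M Rn n) (\<lambda>\<omega>. (Xc \<omega> j, Y \<omega>))"
  have P: "prob_space P" unfolding P_def by (rule Mc.prob_space_distr) measurable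
  have setsP: "sets P = sets (borel \<Otimes>\<^sub>M Rn n)" by (simp add: P_def)
  have fstP: "distr P borel fst = distr Mc borel (\<lambda>\<omega>. Xc \<omega> j)"
    unfolding P_def by (simp add: distr_distr comp_def)
  obtain r where r[measurable]: "r \<in> borel \<Otimes>\<^sub>M Rn n \<rightarrow>\<^sub>M Rn n"
    and r_int: "\<And>f. f \<in> borel_measurable (borel \<Otimes>\<^sub>M Rn n) \<Longrightarrow>
      (\<integral>\<^sup>+z. f z \<partial>P) = (\<integral>\<^sup>+x. \<integral>\<^sup>+z. f (x, r (x, z)) \<partial>?V \<partial>distr Mc borel (\<lambda>\<omega>. Xc \<omega> j))"
    using noise_outsourcing[OF P setsP] unfolding fstP by (elim bexE) (rule that, simp_all)
  have [measurable]: "fst \<in> N \<rightarrow>\<^sub>M Mc" "snd \<in> N \<rightarrow>\<^sub>M Rn n"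
    unfolding N_def by measurable
  have N: "prob_space N" unfolding N_def by (rule N.P.prob_space_axioms)
  have distr_fst: "distr N Mc fst = Mc"
    unfolding N_def by (rule V.distr_pair_fst)
  have "distr N (borel \<Otimes>\<^sub>M Rn n) (\<lambda>\<omega>. (Xc (fst \<omega>) j, Y (fst \<omega>))) =
      distr (distr N Mc fst) (borel \<Otimes>\<^sub>M Rn n) (\<lambda>\<omega>. (Xc \<omega> j, Y \<omega>))"
    by (subst distr_distr) (auto simp: comp_def)
  then have left: "distr N (borel \<Otimes>\<^sub>M Rn n) (\<lambda>\<omega>. (Xc (fst \<omega>) j, Y (fst \<omega>))) = P"
    by (simp add: distr_fst P_def)
  \<comment> \<open>Fubini on \<open>N\<close>, followed by passing from \<open>Mc\<close> to the
    law of \<open>Xc \<omega> j\<close>, produces exactly the iterated integral of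
    \<open>r_int\<close>.\<close>
  have right: "distr N (borel \<Otimes>\<^sub>M Rn n) (\<lambda>\<omega>. (Xc (fst \<omega>) j, r (Xc (fst \<omega>) j, snd \<omega>))) = P"
  proof (rule measure_eqI)
    fix A assume "A \<in> sets (distr N (borel \<Otimes>\<^sub>M Rn n) (\<lambda>\<omega>. (Xc (fst \<omega>) j, r (Xc (fst \<omega>) j, snd \<omega>))))"
    then have A[measurable]: "A \<in> sets (borel \<Otimes>\<^sub>M Rn n)" by simp
    have "emeasure (distr N (borel \<Otimes>\<^sub>M Rn n) (\<lambda>\<omega>. (Xc (fst \<omega>) j, r (Xc (fst \<omega>) j, snd \<omega>)))) A =
        (\<integral>\<^sup>+\<omega>. indicator A (Xc (fst \<omega>) j, r (Xc (fst \<omega>) j, snd \<omega>)) \<partial>N)"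
      by (simp add: nn_integral_distr flip: nn_integral_indicator)
    also have "\<dots> = (\<integral>\<^sup>+\<omega>. \<integral>\<^sup>+z. indicator A (Xc \<omega> j, r (Xc \<omega> j, z)) \<partial>?V \<partial>Mc)"
      unfolding N_def by (subst V.nn_integral_fst[symmetric]) auto
    also have "\<dots> = (\<integral>\<^sup>+x. \<integral>\<^sup>+z. indicator A (x, r (x, z)) \<partial>?V \<partial>distr Mc borel (\<lambda>\<omega>. Xc \<omega> j))"
      by (subst nn_integral_distr) auto
    also have "\<dots> = (\<integral>\<^sup>+z. indicator A z \<partial>P)"
      by (rule r_int[symmetric]) measurable
    also have "\<dots> = emeasure P A"
      by (rule nn_integral_indicator) (simp add: setsP)
    finally show "emeasure (distr N (borel \<Otimes>\<^sub>M Rn n) (\<lambda>\<omega>. (Xc (fst \<omega>) j, r (Xc (fst \<omega>) j, snd \<omega>)))) A = emeasure P A" .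
  qed (simp add: setsP)
  \<comment> \<open>Equality of the joint laws passes to the second marginal, which yields the first
    distributional identity of the dependency model.\<close>
  have marginal: "distr N (Rn n) (\<lambda>\<omega>. g \<omega>) = distr P (Rn n) snd"
    if g: "g \<in> N \<rightarrow>\<^sub>M Rn n" and "distr N (borel \<Otimes>\<^sub>M Rn n) (\<lambda>\<omega>. (Xc (fst \<omega>) j, g \<omega>)) = P" for g
    unfolding that(2)[symmetric] using g by (subst distr_distr) (auto simp: comp_def)
  have indep: "prob_space.indep_vars N (\<lambda>_. borel) (\<lambda>i \<omega>. snd \<omega> i) {1..n}"
    by (rule indep_vars_uniform_cube[OF N]) (auto simp: N_def N.distr_snd)
  \<comment> \<open>\<open>Rn n\<close> and the cube have the same measurable sets, so
    \<open>snd\<close> generates the same sigma-algebra from either, and independence on the product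
    applies.\<close>
  have vimage: "vimage_algebra (space N) snd (Rn n) = vimage_algebra (space N) snd ?V"
    by (rule vimage_algebra_cong) (simp_all add: sets_uniform_cube)
  have indep': "prob_space.indep_set N (sets (vimage_algebra (space N) (\<lambda>\<omega>. Xc (fst \<omega>) j) borel))
       (sets (vimage_algebra (space N) snd (Rn n)))"
    unfolding vimage unfolding N_def by (rule N.indep_set_fst_snd[OF Xj])
  have "dependency_model N d (Xc \<circ> fst) j w r snd"
    unfolding dependency_model_def n_def[symmetric] comp_def Y_def[symmetric]
    using indep indep' left right by (auto simp: marginal)
  moreover have "extends_prob_space N Mc"
    using N distr_fst by (simp add: extends_prob_space_def)
  ultimately show ?thesis by blast
qed

end
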